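(* Let $A_1,\dots,A_N$ be events in a probability space. For $n=1,\dots,N$ let $\alpha_n=P(A_n)$, $\boldsymbol{\alpha}_n=(P(A_1),\dots,P(A_n))^T$, $\boldsymbol{\beta}_n=(P(A_1\cap A_n),\dots,P(A_{n-1}\cap A_n))^T$, and let $\boldsymbol{\Sigma}_n=(P(A_i\cap A_j))_{i,j=1}^n$. Let $n\in\{1,\dots,N\}$ be such that $\boldsymbol{\Sigma}_{n-1}$ is invertible, and put $\boldsymbol{b}_n=-\boldsymbol{\Sigma}_{n-1}^{-1}\boldsymbol{\beta}_n$. Then the following hold. (i) If $\alpha_n-\boldsymbol{\beta}_n^T\boldsymbol{\Sigma}_{n-1}^{-1}\boldsymbol{\beta}_n>0$, then $$\ell_{\mathrm{GK}}(n)=\ell_{\mathrm{GK}}(n-1)+\frac{1}{\alpha_n-\boldsymbol{\beta}_n^T\boldsymbol{\Sigma}_{n-1}^{-1}\boldsymbol{\beta}_n}\,\boldsymbol{\alpha}_n^T\begin{pmatrix}\boldsymbol{b}_n\boldsymbol{b}_n^T & \boldsymbol{b}_n\\ \boldsymbol{b}_n^T & 1\end{pmatrix}\boldsymbol{\alpha}_n .$$ (ii) The matrix $\boldsymbol{\Sigma}_n$ is not invertible if and only if $\alpha_n-\boldsymbol{\beta}_n^T\boldsymbol{\Sigma}_{n-1}^{-1}\boldsymbol{\beta}_n=0$. (iii) The case $\alpha_n-\boldsymbol{\beta}_n^T\boldsymbol{\Sigma}_{n-1}^{-1}\boldsymbol{\beta}_n<0$ never happens, i.e. $$P(A_n)\ge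 \boldsymbol{\beta}_n^T\boldsymbol{\Sigma}_{n-1}^{-1}\boldsymbol{\beta}_n .$$
   Context: For $n$ such that $\boldsymbol{\Sigma}_n=(P(A_i\cap A_j))_{i,j=1}^n$ is invertible, $\ell_{\mathrm{GK}}(n):=\boldsymbol{\alpha}_n^T\boldsymbol{\Sigma}_n^{-1}\boldsymbol{\alpha}_n$ denotes the Gallot--Kounias lower bound on $P\left(\bigcup_{i=1}^n A_i\right)$ computed from the events $A_1,\dots,A_n$. The diagonal entries of $\boldsymbol{\Sigma}_n$ are $P(A_i\cap A_i)=P(A_i)$. For $n=1$ the matrix $\boldsymbol{\Sigma}_0$ and vectors $\boldsymbol{\beta}_1,\boldsymbol{b}_1$ are empty: $\boldsymbol{\Sigma}_0$ is regarded as invertible, $\boldsymbol{\beta}_1^T\boldsymbol{\Sigma}_0^{-1}\boldsymbol{\beta}_1=0$, the block matrix in (i) is the $1\times 1$ matrix $(1)$, and $\ell_{\mathrm{GK}}(0)=0$. *)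

theory Defs
  imports
    "HOL-Probability.Probability"
    "Jordan_Normal_Form.Gauss_Jordan_Elimination"
begin

no_notation inner (infix \<open>\<bullet>\<close> 70)

text \<open>
  Events are numbered \<open>A 1, A 2, \<dots>\<close>, whereas the entries of vectors and matrices are indexed
  from \<open>0\<close>; hence the \<open>Suc\<close> in the definitions below.
  In the usual notation, \<open>prob_vec M A n\<close> is \<open>\<alpha>\<^sub>n\<close>, \<open>cross_vec M A n\<close> is \<open>\<beta>\<^sub>n\<close> (of dimension
  \<open>n - 1\<close>), \<open>joint_mat M A n\<close> is \<open>\<Sigma>\<^sub>n\<close> and \<open>coeff_vec M A n\<close> is \<open>b\<^sub>n = - \<Sigma>\<^sub>n\<^sub>-\<^sub>1\<^sup>-\<^sup>1 \<beta>\<^sub>n\<close>. For \<open>n = 1\<close>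
  the \<open>0\<close>-dimensional vectors and matrices yield the conventions that \<open>\<Sigma>\<^sub>0\<close> is invertible and
  that empty products are \<open>0\<close>.
\<close>

definition prob_vec :: "'a measure \<Rightarrow> (nat \<Rightarrow> 'a set) \<Rightarrow> nat \<Rightarrow> real vec" where
  "prob_vec M A n = vec n (\<lambda>i. measure M (A (Suc i)))"

definition cross_vec :: "'a measure \<Rightarrow> (nat \<Rightarrow> 'a set) \<Rightarrow> nat \<Rightarrow> real vec" where
  "cross_vec M A n = vec (n - 1) (\<lambda>i. measure M (A (Suc i) \<inter> A n))"

definition joint_mat :: "'a measure \<Rightarrow> (nat \<Rightarrow> 'a set) \<Rightarrow> nat \<Rightarrow> real mat" where
  "joint_mat M A n = mat n n (\<lambda>(i, j). measure M (A (Suc i) \<inter> A (Suc j)))"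

text \<open>Meaningful only for an invertible matrix; otherwise the value is unspecified.\<close>

definition inv_mat :: "real mat \<Rightarrow> real mat" where
  "inv_mat S = the (mat_inverse S)"

text \<open>The Gallot--Kounias lower bound, meaningful only if \<open>joint_mat M A n\<close> is invertible.\<close>

definition gallot_kounias :: "'a measure \<Rightarrow> (nat \<Rightarrow> 'a set) \<Rightarrow> nat \<Rightarrow> real" where
  "gallot_kounias M A n = prob_vec M A n \<bullet> (inv_mat (joint_mat M A n) *\<^sub>v prob_vec M A n)"

definition coeff_vec :: "'a measure \<Rightarrow> (nat \<Rightarrow> 'a set) \<Rightarrow> nat \<Rightarrow> real vec" where
  "coeff_vec M A n = - (inv_mat (joint_mat M A (n - 1)) *\<^sub>v cross_vec M A n)"

definition col_mat :: "real vec \<Rightarrow> real mat" where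
  "col_mat b = mat_of_cols (dim_vec b) [b]"

definition bordered_mat :: "real vec \<Rightarrow> real mat" where
  "bordered_mat b =
    four_block_mat (col_mat b * (col_mat b)\<^sup>T) (col_mat b) ((col_mat b)\<^sup>T) (1\<^sub>m 1)"

end

theory Submission
  imports Defs "Jordan_Normal_Form.Determinant"
begin

text \<open>
  Write \<open>m = n - 1\<close>, \<open>S = \<Sigma>\<^sub>m\<close>, \<open>\<beta> = \<beta>\<^sub>n\<close> and let \<open>c = \<alpha>\<^sub>n - \<beta>\<^sup>T S\<^sup>-\<^sup>1 \<beta>\<close> be the Schur complement
  of \<open>S\<close> in \<open>\<Sigma>\<^sub>n\<close>, which is \<open>S\<close> bordered by the column \<open>\<beta>\<close>, the row \<open>\<beta>\<^sup>T\<close> and the corner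
  entry \<open>\<alpha>\<^sub>n\<close>. Everything comes from the single vector \<open>w = (b\<^sub>n, 1)\<close>, where \<open>b\<^sub>n = - S\<^sup>-\<^sup>1 \<beta>\<close>:
  the first \<open>m\<close> entries of \<open>\<Sigma>\<^sub>n w\<close> vanish and the last one is \<open>c\<close>
  (\<open>border_mult_kernel_vec\<close>). This has three consequences.

  \<^item> \<open>w\<^sup>T \<Sigma>\<^sub>n w = c\<close>. Since \<open>\<Sigma>\<^sub>n\<close> is the Gram matrix of the indicators of the events in \<open>L\<^sup>2\<close>, its
    quadratic form is nonnegative (\<open>joint_mat_quadratic_form_nonneg\<close>), so \<open>c \<ge> 0\<close>.
  \<^item> If \<open>c = 0\<close>, then \<open>w\<close> is a nonzero vector in the kernel of \<open>\<Sigma>\<^sub>n\<close>, so \<open>\<Sigma>\<^sub>n\<close> is singular.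
  \<^item> If \<open>c \<noteq> 0\<close>, then \<open>S\<^sup>-\<^sup>1\<close> padded with zeros, plus \<open>w w\<^sup>T / c\<close>, is inverse to \<open>\<Sigma>\<^sub>n\<close>
    (\<open>border_right_inverse\<close>). Evaluating its quadratic form at \<open>\<alpha>\<^sub>n\<close> gives the recursion for
    the Gallot--Kounias bound: the padded block contributes the bound for \<open>m\<close> events, and
    \<open>w w\<^sup>T\<close> is the block matrix in the correction term.
\<close>

section \<open>Matrix preliminaries\<close>

text \<open>
  The witness in \<open>invertible_mat\<close> leaves its own dimensions open; they are forced here by
  comparing the dimensions of the two products with those of the identity matrices.
\<close>

lemma inv_mat_inverse:
  assumes S: "S \<in> carrier_mat m m" and "invertible_mat S"
  shows "inv_mat S \<in> carrier_mat m m" "S * inv_mat S = 1\<^sub>m m" "inv_mat S * S = 1\<^sub>m m"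
proof -
  obtain B where SB: "S * B = 1\<^sub>m m" and BS: "B * S = 1\<^sub>m (dim_row B)"
    using assms unfolding invertible_mat_def inverts_mat_def by auto
  have "dim_col (S * B) = m" "dim_col (B * S) = dim_row B"
    by (simp_all only: SB BS index_one_mat)
  then have B: "B \<in> carrier_mat m m"
    using S by auto
  have "S \<in> Units (ring_mat TYPE(real) m undefined)"
    using S B SB BS unfolding Units_def ring_mat_def by auto
  then obtain C where "mat_inverse S = Some C"
    using mat_inverse(1)[OF S, where b = undefined] by (cases "mat_inverse S") auto
  with mat_inverse(2)[OF S this]
  show "inv_mat S \<in> carrier_mat m m" "S * inv_mat S = 1\<^sub>m m" "inv_mat S * S = 1\<^sub>m m"
    by (auto simp: inv_mat_def)
qed

lemma right_inverse_imp_invertible_mat: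
  fixes S :: "real mat"
  assumes S: "S \<in> carrier_mat m m" and V: "V \<in> carrier_mat m m" and SV: "S * V = 1\<^sub>m m"
  shows "invertible_mat S" "inv_mat S = V"
proof -
  have VS: "V * S = 1\<^sub>m m"
    by (rule mat_mult_left_right_inverse[OF S V SV])
  show inv: "invertible_mat S"
    using S V SV VS unfolding invertible_mat_def inverts_mat_def by auto
  note I = inv_mat_inverse[OF S inv]
  have "inv_mat S = inv_mat S * (S * V)"
    using I(1) by (simp add: SV)
  also have "\<dots> = inv_mat S * S * V"
    using assoc_mult_mat[OF I(1) S V] by simp
  also have "\<dots> = V"
    using V by (simp add: I(3))
  finally show "inv_mat S = V" .
qed

lemma right_inverse_symmetric:
  fixes S :: "real mat"
  assumes S: "S \<in> carrier_mat m m" and V: "V \<in> carrier_mat m m" and SV: "S * V = 1\<^sub>m m"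
    and sym: "S\<^sup>T = S"
  shows "V\<^sup>T = V"
proof -
  have "V\<^sup>T * S = 1\<^sub>m m"
    using transpose_mult[OF S V] by (simp add: SV sym)
  then have "S * V\<^sup>T = 1\<^sub>m m"
    using mat_mult_left_right_inverse[of "V\<^sup>T" m S] S V by simp
  then show ?thesis
    using right_inverse_imp_invertible_mat(2)[OF S _ SV] 
      right_inverse_imp_invertible_mat(2)[OF S, of "V\<^sup>T"] V by simp
qed

lemma smult_mat_mult_vec:
  fixes B :: "real mat"
  assumes "B \<in> carrier_mat r s" "v \<in> carrier_vec s"
  shows "(k \<cdot>\<^sub>m B) *\<^sub>v v = k \<cdot>\<^sub>v (B *\<^sub>v v)"
  using assms by (intro eq_vecI) auto

lemma col_mat_dim [simp]: "dim_row (col_mat u) = dim_vec u" "dim_col (col_mat u) = 1"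
  by (auto simp: col_mat_def)

lemma col_mat_index [simp]: "i < dim_vec u \<Longrightarrow> col_mat u $$ (i, 0) = u $ i"
  by (auto simp: col_mat_def mat_of_cols_def)

lemma col_col_mat [simp]: "col (col_mat u) 0 = u"
  by (intro eq_vecI) auto

lemma mult_col_mat:
  assumes "dim_col T = dim_vec u"
  shows "T * col_mat u = col_mat (T *\<^sub>v u)"
  by (rule eq_matI) (simp_all add: less_Suc_eq)

text \<open>
  Reading the four blocks as one outer product reduces multiplication by this matrix to a single
  matrix-vector product with \<open>(b, 1)\<close>.
\<close>

lemma index_bordered_mat:
  assumes b: "b \<in> carrier_vec m"
    and "i < Suc m" "j < Suc m"
  shows "bordered_mat b $$ (i, j)
    = (b @\<^sub>v vec 1 (\<lambda>_. 1)) $ i * (b @\<^sub>v vec 1 (\<lambda>_. 1)) $ j"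
  using assms
  by (auto simp: bordered_mat_def col_mat_def mat_of_cols_def scalar_prod_def)

lemma bordered_mat_carrier:
  "b \<in> carrier_vec m \<Longrightarrow> bordered_mat b \<in> carrier_mat (Suc m) (Suc m)"
  by (intro carrier_matI) (auto simp: bordered_mat_def col_mat_def)

section \<open>Bordering a symmetric invertible matrix\<close>

locale symmetric_border =
  fixes m :: nat and S T :: "real mat" and \<beta> :: "real vec" and a :: real
  assumes S: "S \<in> carrier_mat m m" and T: "T \<in> carrier_mat m m"
    and \<beta>: "\<beta> \<in> carrier_vec m"
    and S_sym: "S\<^sup>T = S" and ST: "S * T = 1\<^sub>m m"
begin

definition border :: "real mat" where
  "border = four_block_mat S (col_mat \<beta>) (col_mat \<beta>)\<^sup>T (a \<cdot>\<^sub>m 1\<^sub>m 1)"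

definition schur_complement :: real where
  "schur_complement = a - \<beta> \<bullet> (T *\<^sub>v \<beta>)"

text \<open>
  The vector \<open>(b, 1)\<close> with \<open>b = - T \<beta>\<close>; it lies in the kernel of \<open>border\<close> precisely when the
  Schur complement is zero.
\<close>

definition kernel_vec :: "real vec" where
  "kernel_vec = (- (T *\<^sub>v \<beta>)) @\<^sub>v vec 1 (\<lambda>_. 1)"

definition padded_inverse :: "real mat" where
  "padded_inverse = four_block_mat T (0\<^sub>m m 1) (0\<^sub>m 1 m) (0\<^sub>m 1 1)"

lemma col_beta: "col_mat \<beta> \<in> carrier_mat m 1"
  using \<beta> by (intro carrier_matI) auto

lemma border_carrier: "border \<in> carrier_mat (Suc m) (Suc m)"
  using S by (intro carrier_matI) (auto simp: border_def)

lemma kernel_vec_carrier: "kernel_vec \<in> carrier_vec (Suc m)"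
  using T by (intro carrier_vecI) (auto simp: kernel_vec_def)

lemma kernel_vec_last: "kernel_vec $ m = 1"
  using T by (auto simp: kernel_vec_def)

lemma padded_inverse_carrier: "padded_inverse \<in> carrier_mat (Suc m) (Suc m)"
  using T by (intro carrier_matI) (auto simp: padded_inverse_def)

lemma T_sym: "T\<^sup>T = T"
  by (rule right_inverse_symmetric[OF S T ST S_sym])

lemma coeff_carrier: "- (T *\<^sub>v \<beta>) \<in> carrier_vec m"
  using mult_mat_vec_carrier[OF T \<beta>] by simp

lemmas border_coeff_carrier = bordered_mat_carrier[OF coeff_carrier]

text \<open>
  Block elimination: the coefficients \<open>- T \<beta>\<close> are chosen so that \<open>S\<close> applied to them cancels
  the border column \<open>\<beta>\<close>; what survives in the last coordinate is \<open>a - \<beta>\<^sup>T T \<beta>\<close>.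
\<close>

lemma border_mult_kernel_vec:
  "border *\<^sub>v kernel_vec = schur_complement \<cdot>\<^sub>v unit_vec (Suc m) m"
proof -
  let ?e = "vec 1 (\<lambda>_. 1) :: real vec"
  have Tb: "T *\<^sub>v \<beta> \<in> carrier_vec m"
    using T \<beta> by (rule mult_mat_vec_carrier)
  have "S *\<^sub>v (T *\<^sub>v \<beta>) = \<beta>"
    using assoc_mult_mat_vec[OF S T \<beta>] \<beta> by (simp add: ST)
  moreover have "S *\<^sub>v (- (T *\<^sub>v \<beta>)) = - (S *\<^sub>v (T *\<^sub>v \<beta>))"
    using S T by (intro eq_vecI) auto
  moreover have "col_mat \<beta> *\<^sub>v ?e = \<beta>"
    by (intro eq_vecI) (auto simp: col_mat_def mat_of_cols_def scalar_prod_def)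
  ultimately have top: "S *\<^sub>v (- (T *\<^sub>v \<beta>)) + col_mat \<beta> *\<^sub>v ?e = 0\<^sub>v m"
    using \<beta> by (simp add: uminus_l_inv_vec)
  have bottom: "(col_mat \<beta>)\<^sup>T *\<^sub>v (- (T *\<^sub>v \<beta>)) + (a \<cdot>\<^sub>m 1\<^sub>m 1) *\<^sub>v ?e
      = vec 1 (\<lambda>_. schur_complement)"
    using T \<beta> Tb
    by (intro eq_vecI) (auto simp: col_mat_def schur_complement_def)
  have "border *\<^sub>v kernel_vec = 0\<^sub>v m @\<^sub>v vec 1 (\<lambda>_. schur_complement)"
    unfolding border_def kernel_vec_def
    using four_block_mat_mult_vec[OF S col_beta, of "(col_mat \<beta>)\<^sup>T" 1 "a \<cdot>\<^sub>m 1\<^sub>m 1" "- (T *\<^sub>v \<beta>)" ?e]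
      col_beta Tb top bottom by auto
  also have "\<dots> = schur_complement \<cdot>\<^sub>v unit_vec (Suc m) m"
    by (intro eq_vecI) auto
  finally show ?thesis .
qed

lemma kernel_vec_quadratic_form:
  "kernel_vec \<bullet> (border *\<^sub>v kernel_vec) = schur_complement"
  using kernel_vec_carrier by (simp add: border_mult_kernel_vec kernel_vec_last)

text \<open>
  The padded matrix fails to invert \<open>border\<close> only in the last row. By the symmetry of \<open>T\<close>, the
  error there is the row \<open>(T \<beta>)\<^sup>T\<close>, which the rank-one correction below removes.
\<close>

lemma border_mult_padded_inverse:
  "border * padded_inverse
    = four_block_mat (1\<^sub>m m) (0\<^sub>m m 1) (col_mat (T *\<^sub>v \<beta>))\<^sup>T (0\<^sub>m 1 1)"
proof -
  have "(col_mat \<beta>)\<^sup>T * T = (T * col_mat \<beta>)\<^sup>T"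
    using transpose_mult[OF T col_beta] by (simp only: T_sym)
  also have "T * col_mat \<beta> = col_mat (T *\<^sub>v \<beta>)"
    using T \<beta> by (intro mult_col_mat) simp
  finally show ?thesis
    unfolding border_def padded_inverse_def
    using mult_four_block_mat[OF S col_beta, of "(col_mat \<beta>)\<^sup>T" 1 "a \<cdot>\<^sub>m 1\<^sub>m 1" T m "0\<^sub>m m 1" 1 "0\<^sub>m 1 m" "0\<^sub>m 1 1"]
      S T col_beta carrier_vecD[OF \<beta>] by (auto simp: ST intro!: cong_four_block_mat eq_matI)
qed

text \<open>
  Since the bordered matrix is \<open>w w\<^sup>T\<close> with \<open>w\<close> the vector \<open>kernel_vec\<close>, the product is
  \<open>(border w) w\<^sup>T\<close>, and \<open>border w\<close> is concentrated in the last coordinate.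
\<close>

lemma border_mult_bordered_mat:
  assumes "i < Suc m" "j < Suc m"
  shows "(border * bordered_mat (- (T *\<^sub>v \<beta>))) $$ (i, j)
    = (if i = m then schur_complement * kernel_vec $ j else 0)"
proof -
  have "col (bordered_mat (- (T *\<^sub>v \<beta>))) j = kernel_vec $ j \<cdot>\<^sub>v kernel_vec"
  proof (rule eq_vecI)
    fix k assume "k < dim_vec (kernel_vec $ j \<cdot>\<^sub>v kernel_vec)"
    then have k: "k < Suc m"
      using kernel_vec_carrier by simp
    then show "col (bordered_mat (- (T *\<^sub>v \<beta>))) j $ k = (kernel_vec $ j \<cdot>\<^sub>v kernel_vec) $ k"
      using index_bordered_mat[OF coeff_carrier k assms(2), folded kernel_vec_def]
        carrier_matD[OF border_coeff_carrier] kernel_vec_carrier assms(2)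
      by simp
  qed (use carrier_matD[OF border_coeff_carrier] kernel_vec_carrier in simp)
  then have "(border * bordered_mat (- (T *\<^sub>v \<beta>))) $$ (i, j)
      = row border i \<bullet> (kernel_vec $ j \<cdot>\<^sub>v kernel_vec)"
    using carrier_matD[OF border_carrier] carrier_matD[OF border_coeff_carrier] assms by simp
  also have "\<dots> = kernel_vec $ j * (border *\<^sub>v kernel_vec) $ i"
    using carrier_matD[OF border_carrier] carrier_vecD[OF kernel_vec_carrier] assms by simp
  also have "\<dots> = (if i = m then schur_complement * kernel_vec $ j else 0)"
    using assms by (simp add: border_mult_kernel_vec)
  finally show ?thesis .
qed

text \<open>
  After division by the Schur complement, the correction has last row \<open>w\<^sup>T = (- (T \<beta>)\<^sup>T, 1)\<close> and
  is zero elsewhere: this cancels the error row of the padded inverse and supplies the missing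
  corner entry \<open>1\<close>.
\<close>

lemma border_right_inverse:
  assumes c: "schur_complement \<noteq> 0"
  shows "border * (padded_inverse + (1 / schur_complement) \<cdot>\<^sub>m bordered_mat (- (T *\<^sub>v \<beta>)))
    = 1\<^sub>m (Suc m)" (is "border * (_ + ?k \<cdot>\<^sub>m ?B) = _")
proof -
  have B: "?B \<in> carrier_mat (Suc m) (Suc m)"
    by (rule border_coeff_carrier)
  have "border * (padded_inverse + ?k \<cdot>\<^sub>m ?B) = border * padded_inverse + ?k \<cdot>\<^sub>m (border * ?B)"
    using border_carrier padded_inverse_carrier B
    by (simp add: mult_add_distrib_mat[of _ "Suc m" "Suc m"]
        mult_smult_distrib[of _ "Suc m" "Suc m"])
  also have "\<dots> = 1\<^sub>m (Suc m)"
    using c border_carrier B T \<beta>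
    by (intro eq_matI)
      (auto simp: border_mult_padded_inverse border_mult_bordered_mat kernel_vec_def
        col_mat_def mat_of_cols_def simp del: index_mult_mat(1))
  finally show ?thesis .
qed

lemma invertible_border_iff: "invertible_mat border \<longleftrightarrow> schur_complement \<noteq> 0"
proof
  assume inv: "invertible_mat border"
  show "schur_complement \<noteq> 0"
  proof
    assume "schur_complement = 0"
    then have "border *\<^sub>v kernel_vec = 0\<^sub>v (Suc m)"
      by (auto simp: border_mult_kernel_vec)
    then have "inv_mat border *\<^sub>v (border *\<^sub>v kernel_vec) = 0\<^sub>v (Suc m)"
      using inv_mat_inverse(1)[OF border_carrier inv] by auto
    then have "kernel_vec = 0\<^sub>v (Suc m)"
      using assoc_mult_mat_vec[OF inv_mat_inverse(1)[OF border_carrier inv] border_carrier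
          kernel_vec_carrier] kernel_vec_carrier
      by (simp add: inv_mat_inverse(3)[OF border_carrier inv])
    then show False
      using kernel_vec_last by simp
  qed
next
  assume "schur_complement \<noteq> 0"
  then show "invertible_mat border"
    using right_inverse_imp_invertible_mat(1)[OF border_carrier _ border_right_inverse]
      padded_inverse_carrier border_coeff_carrier by simp
qed

lemma inv_border_quadratic_form:
  fixes t :: real
  assumes c: "schur_complement \<noteq> 0" and u: "u \<in> carrier_vec m"
  defines "v \<equiv> u @\<^sub>v vec 1 (\<lambda>_. t)"
  shows "v \<bullet> (inv_mat border *\<^sub>v v)
    = u \<bullet> (T *\<^sub>v u) + 1 / schur_complement * (v \<bullet> (bordered_mat (- (T *\<^sub>v \<beta>)) *\<^sub>v v))"
proof -
  let ?B = "bordered_mat (- (T *\<^sub>v \<beta>))"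
  have B: "?B \<in> carrier_mat (Suc m) (Suc m)"
    by (rule border_coeff_carrier)
  have v: "v \<in> carrier_vec (Suc m)"
    using u by (intro carrier_vecI) (auto simp: v_def)
  have "inv_mat border = padded_inverse + (1 / schur_complement) \<cdot>\<^sub>m ?B"
    using right_inverse_imp_invertible_mat(2)[OF border_carrier _ border_right_inverse[OF c]]
      padded_inverse_carrier B by auto
  then have "inv_mat border *\<^sub>v v
      = padded_inverse *\<^sub>v v + (1 / schur_complement) \<cdot>\<^sub>v (?B *\<^sub>v v)"
    using padded_inverse_carrier B v
    by (simp add: add_mult_distrib_mat_vec[of _ "Suc m" "Suc m"] smult_mat_mult_vec)
  then have "v \<bullet> (inv_mat border *\<^sub>v v)
      = v \<bullet> (padded_inverse *\<^sub>v v) + 1 / schur_complement * (v \<bullet> (?B *\<^sub>v v))"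
    using padded_inverse_carrier B v
    by (simp add: scalar_prod_add_distrib[of _ "Suc m"])
  also have "padded_inverse *\<^sub>v v = (T *\<^sub>v u) @\<^sub>v 0\<^sub>v 1"
    unfolding padded_inverse_def v_def
    using four_block_mat_mult_vec[OF T, of "0\<^sub>m m 1" 1 "0\<^sub>m 1 m" 1 "0\<^sub>m 1 1" u "vec 1 (\<lambda>_. t)"] T u
    by (auto intro!: arg_cong2[where f = append_vec])
  also have "v \<bullet> ((T *\<^sub>v u) @\<^sub>v 0\<^sub>v 1) = u \<bullet> (T *\<^sub>v u)"
    unfolding v_def using scalar_prod_append[of u m "vec 1 (\<lambda>_. t)" 1 "T *\<^sub>v u" "0\<^sub>v 1"] T u
    by auto
  finally show ?thesis .
qed

end

section \<open>Matrices of joint probabilities\<close>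

text \<open>
  The quadratic form at \<open>x\<close> is the second moment of the random variable
  \<open>\<Sum>i. x\<^sub>i * indicator (A\<^sub>i)\<close>.
\<close>

lemma joint_mat_quadratic_form_nonneg:
  assumes "prob_space M" and A: "\<And>i. i < n \<Longrightarrow> A (Suc i) \<in> sets M"
    and x: "x \<in> carrier_vec n"
  shows "x \<bullet> (joint_mat M A n *\<^sub>v x) \<ge> 0"
proof -
  interpret prob_space M by fact
  let ?f = "\<lambda>\<omega>. \<Sum>i<n. x $ i * indicator (A (Suc i)) \<omega>"
  have "(\<integral>\<omega>. (?f \<omega>)\<^sup>2 \<partial>M)
    = (\<integral>\<omega>. (\<Sum>i<n. \<Sum>j<n. x $ i * x $ j * indicator (A (Suc i) \<inter> A (Suc j)) \<omega>) \<partial>M)"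
    by (intro Bochner_Integration.integral_cong refl)
      (simp only: power2_eq_square sum_product indicator_inter_arith mult_ac)
  also have "\<dots> = (\<Sum>i<n. \<Sum>j<n. x $ i * x $ j * prob (A (Suc i) \<inter> A (Suc j)))"
    using A
    by (intro has_bochner_integral_integral_eq has_bochner_integral_sum
        has_bochner_integral_mult_right has_bochner_integral_real_indicator)
      (auto simp: emeasure_eq_measure)
  also have "\<dots> = x \<bullet> (joint_mat M A n *\<^sub>v x)"
    using x by (simp add: scalar_prod_def joint_mat_def sum_distrib_left atLeast0LessThan mult_ac)
  finally show ?thesis
    using Bochner_Integration.integral_nonneg[of M "\<lambda>\<omega>. (?f \<omega>)\<^sup>2"] by simp
qed

lemma joint_mat_border:
  assumes "n = Suc m"
  shows "joint_mat M A n = four_block_mat (joint_mat M A m) (col_mat (cross_vec M A n))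
    (col_mat (cross_vec M A n))\<^sup>T (measure M (A n) \<cdot>\<^sub>m 1\<^sub>m 1)"
  using assms
  by (intro eq_matI)
    (auto simp: joint_mat_def cross_vec_def col_mat_def mat_of_cols_def less_Suc_eq Int_commute)

lemma prob_vec_Suc: "prob_vec M A (Suc m) = prob_vec M A m @\<^sub>v vec 1 (\<lambda>_. measure M (A (Suc m)))"
  by (intro eq_vecI) (auto simp: prob_vec_def less_Suc_eq)

theorem theorem3p3:
  fixes M :: "'a measure" and A :: "nat \<Rightarrow> 'a set" and N n :: nat
  assumes "prob_space M"
    and "\<And>i. i \<in> {1..N} \<Longrightarrow> A i \<in> sets M"
    and "n \<in> {1..N}"
    and "invertible_mat (joint_mat M A (n - 1))"
  shows
    "(measure M (A n) - cross_vec M A n \<bullet> (inv_mat (joint_mat M A (n - 1)) *\<^sub>v cross_vec M A n) > 0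
      \<longrightarrow> gallot_kounias M A n = gallot_kounias M A (n - 1)
        + 1 / (measure M (A n)
               - cross_vec M A n \<bullet> (inv_mat (joint_mat M A (n - 1)) *\<^sub>v cross_vec M A n))
          * (prob_vec M A n \<bullet> (bordered_mat (coeff_vec M A n) *\<^sub>v prob_vec M A n)))
    \<and> (\<not> invertible_mat (joint_mat M A n)
      \<longleftrightarrow> measure M (A n)
          - cross_vec M A n \<bullet> (inv_mat (joint_mat M A (n - 1)) *\<^sub>v cross_vec M A n) = 0)
    \<and> measure M (A n)
      \<ge> cross_vec M A n \<bullet> (inv_mat (joint_mat M A (n - 1)) *\<^sub>v cross_vec M A n)"
proof -
  define m where "m = n - 1"
  have n: "n = Suc m"
    using assms(3) by (simp add: m_def)
  let ?S = "joint_mat M A m" and ?\<beta> = "cross_vec M A n" and ?a = "measure M (A n)"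
  let ?T = "inv_mat ?S"
  have S: "?S \<in> carrier_mat m m"
    by (simp add: joint_mat_def)
  have inv: "invertible_mat ?S"
    using assms(4) by (simp add: m_def)
  interpret symmetric_border m ?S ?T ?\<beta> ?a
  proof
    show "?S\<^sup>T = ?S"
      by (intro eq_matI) (auto simp: joint_mat_def Int_commute)
  qed (use S inv_mat_inverse[OF S inv] in \<open>auto simp: cross_vec_def n\<close>)
  have border: "joint_mat M A n = border"
    unfolding border_def by (rule joint_mat_border[OF n])
  have "0 \<le> kernel_vec \<bullet> (joint_mat M A n *\<^sub>v kernel_vec)"
    by (rule joint_mat_quadratic_form_nonneg)
      (use assms(1-3) kernel_vec_carrier in \<open>auto simp: n\<close>)
  then have nonneg: "schur_complement \<ge> 0"
    by (simp add: border kernel_vec_quadratic_form)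
  have "gallot_kounias M A n = gallot_kounias M A m
      + 1 / schur_complement * (prob_vec M A n \<bullet> (bordered_mat (coeff_vec M A n) *\<^sub>v prob_vec M A n))"
    if "schur_complement > 0"
    using inv_border_quadratic_form[of "prob_vec M A m" "measure M (A (Suc m))"] that
    by (simp add: gallot_kounias_def coeff_vec_def border prob_vec_Suc[of M A m, folded n]
        m_def[symmetric]) (simp add: n prob_vec_def)
  with nonneg invertible_border_iff show ?thesis
    unfolding border m_def[symmetric] schur_complement_def by auto
qed

end
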